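(* Let $U_A,U_B,U_{A'},U_{B'}$ be cubic-to-orthorhombic martensitic variants such that $U_A,U_B$ have different distinguished axes (so that they can form a Type-II twin) and $U_{A'},U_{B'}$ are the compound counterparts of $U_A,U_B$ respectively. Let rotations $R_{IJ}\in SO(3)$, non-zero vectors $b_{IJ}\in\mathbb{R}^3$ and unit vectors $n_{IJ}\in\mathbb{R}^3$ satisfy $$R_{AB}U_B-U_A=b_{AB}\otimes n_{AB},\qquad R_{A'B'}U_{B'}-U_{A'}=b_{A'B'}\otimes n_{A'B'},$$ $$R_{AA'}U_{A'}-U_A=b_{AA'}\otimes n_{AA'},\qquad R_{BB'}U_{B'}-U_B=b_{BB'}\otimes n_{BB'},$$ where the first two are Type-II twins, $n_{AA'}=n_{BB'}$, and $R_{AB}R_{BB'}=R_{AA'}R_{A'B'}$. For $\lambda,\Lambda\in[0,1]$ let $$M_{AB}=(1-\lambda)U_A+\lambda R_{AB}U_B,\qquad M_{A'B'}=(1-\lambda)U_{A'}+\lambda R_{A'B'}U_{B'},$$ $$M=M(\lambda,\Lambda)=(1-\Lambda)M_{AB}+\Lambda R_{AA'}M_{A'B'},\qquad g(\lambda,\Lambda)=\det(M^TM-\mathbf{1}).$$ Then for all $\lambda,\Lambda\in[0,1]$ $$g(\lambda,\Lambda)=a_0+a_1(\lambda^2-\lambda)+a_2(\Lambda^2-\Lambda)+a_3(\lambda^2-\lambda)(\Lambda^2-\Lambda),$$ where $$a_0=\det(U_A^2-\mathbf{1}),\qquad a_1=-2\,b_{AB}\cdot U_A\,\mathrm{cof}(U_A^2-\mathbf{1})\,n_{AB},\qquad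 a_2=-2\,b_{AA'}\cdot U_A\,\mathrm{cof}(U_A^2-\mathbf{1})\,n_{AA'},$$ $$a_3=4\,\mathrm{cof}\big(A_0+\tfrac12A_2\big)\cdot\big(A_1+\tfrac12A_3\big)+4a_1,$$ with $\eta=\dfrac{2}{|b_{AB}|^2}\,b_{AA'}\cdot b_{AB}$ and $$A_0=U_A^2-\mathbf{1},\qquad A_1=U_Ab_{AB}\otimes n_{AB}+n_{AB}\otimes U_A^{-1}b_{AB},\qquad A_2=U_Ab_{AA'}\otimes n_{AA'}+n_{AA'}\otimes U_A^{-1}b_{AA'},$$ $$A_3=-\big(U_A^{-1}n_{AB}\cdot b_{AA'}+\eta\big)\,n_{AA'}\otimes U_A^{-1}b_{AB}-\eta\,U_Ab_{AB}\otimes n_{AA'}.$$ Moreover, if $a_3\neq0$ and $\frac{a_1}{a_3}\notin[0,\frac14]$, then for $\lambda,\Lambda\in[0,1]$ one has $g(\lambda,\Lambda)=0$ if and only if $$\lambda^2-\lambda=-\frac{a_0+a_2(\Lambda^2-\Lambda)}{a_1+a_3(\Lambda^2-\Lambda)}.$$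
   Context: All matrices are real $3\times3$; $\mathbf{1}$ is the identity, $(b\otimes n)_{ij}=b_in_j$, $\mathrm{cof}$ is the cofactor matrix (so $\mathrm{cof}(X)=(\det X)X^{-T}$ for invertible $X$), and for matrices $X\cdot Y=\mathrm{tr}(X^TY)$; for vectors $\cdot$ is the usual dot product. Cubic-to-orthorhombic variants: fix $\alpha,\beta,\gamma>0$ with $\alpha\neq\gamma$ and put $t=\frac{\alpha+\gamma}{2}$, $s=\frac{\alpha-\gamma}{2}$. The six variants are the symmetric positive definite matrices $$U_{1}=\begin{pmatrix}\beta&0&0\\ 0&t&s\\ 0&s&t\end{pmatrix},\quad U_{2}=\begin{pmatrix}\beta&0&0\\ 0&t&-s\\ 0&-s&t\end{pmatrix},\quad U_{3}=\begin{pmatrix}t&0&s\\ 0&\beta&0\\ s&0&t\end{pmatrix},$$ $$U_{4}=\begin{pmatrix}t&0&-s\\ 0&\beta&0\\ -s&0&t\end{pmatrix},\quad U_{5}=\begin{pmatrix}t&s&0\\ s&t&0\\ 0&0&\beta\end{pmatrix},\quad U_{6}=\begin{pmatrix}t&-s&0\\ -s&t&0\\ 0&0&\beta\end{pmatrix}.$$ The distinguished axis of a variant is the coordinate axis carrying the entry $\beta$ in this list ($e_1$ for $U_1,U_2$; $e_2$ for $U_3,U_4$; $e_3$ for $U_5,U_6$). The compound counterpart of a variant is the other variant with the same distinguished axis (pairs $\{U_1,U_2\}$, $\{U_3,U_4\}$, $\{U_5,U_6\}$). Twins: if $U_I,U_J$ are variants with different distinguished axes, there is a unit vector $p$ (unique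 up to sign), of the form $(e_k\pm e_l)/\sqrt2$ with $e_k,e_l$ the two distinguished axes, such that $U_J=PU_IP$ with $P=-\mathbf{1}+2p\otimes p$ (the $180^\circ$ rotation about $p$). A solution of $R\,U_J-U_I=b\otimes n$ with $R\in SO(3)$ and $b,n\neq0$ is called a Type-II twin if $b$ is parallel to $U_Ip$ (the other solution, with $n$ parallel to $p$, is the Type-I twin). *)

theory Defs
  imports "HOL-Analysis.Analysis"
begin

definition outer :: "real^3 \<Rightarrow> real^3 \<Rightarrow> real^3^3" (infixl "\<otimes>" 75)
  where "b \<otimes> n = (\<chi> i j. b $ i * n $ j)"

text \<open>
  The entry \<open>(i, j)\<close> of the cofactor matrix is the signed minor obtained by deleting row \<open>i\<close> and
  column \<open>j\<close>. It is written as the determinant of the matrix whose row \<open>i\<close> is replaced by the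
  \<open>j\<close>-th unit vector, which has this value by Laplace expansion along row \<open>i\<close>.
\<close>

definition cof :: "real^3^3 \<Rightarrow> real^3^3"
  where "cof X = (\<chi> i j. det (\<chi> k l. if k = i then (if l = j then 1 else 0) else X $ k $ l))"

lemma cof_eq_det_inverse_transpose:
  assumes "invertible X"
  shows "cof X = det X *\<^sub>R transpose (matrix_inv X)"
proof -
  have inverse: "matrix_inv X ** X = mat 1"
    using assms someI_ex[of "\<lambda>Y. X ** Y = mat 1 \<and> Y ** X = mat 1"]
    by (auto simp: matrix_inv_def invertible_def)
  have "cof X ** transpose X = det X *\<^sub>R mat 1"
    by (simp add: vec_eq_iff forall_3 cof_def matrix_matrix_mult_def sum_3 det_3 transpose_def mat_def
        algebra_simps)
  then have "cof X ** transpose X ** transpose (matrix_inv X) =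
      (det X *\<^sub>R mat 1) ** transpose (matrix_inv X)"
    by simp
  moreover have "transpose X ** transpose (matrix_inv X) = mat 1"
    by (simp add: inverse transpose_mat flip: matrix_transpose_mul)
  ultimately show ?thesis
    by (simp flip: matrix_mul_assoc scalar_matrix_assoc)
qed

definition matrix_inner :: "real^3^3 \<Rightarrow> real^3^3 \<Rightarrow> real"
  where "matrix_inner X Y = trace (transpose X ** Y)"

datatype variant = V1 | V2 | V3 | V4 | V5 | V6

definition variant_matrix :: "real \<Rightarrow> real \<Rightarrow> real \<Rightarrow> variant \<Rightarrow> real^3^3"
  where
    "variant_matrix \<alpha> \<beta> \<gamma> I =
      (let t = (\<alpha> + \<gamma>) / 2; s = (\<alpha> - \<gamma>) / 2 in
        case I of
          V1 \<Rightarrow> vector [vector [\<beta>, 0, 0], vector [0, t, s], vector [0, s, t]]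
        | V2 \<Rightarrow> vector [vector [\<beta>, 0, 0], vector [0, t, -s], vector [0, -s, t]]
        | V3 \<Rightarrow> vector [vector [t, 0, s], vector [0, \<beta>, 0], vector [s, 0, t]]
        | V4 \<Rightarrow> vector [vector [t, 0, -s], vector [0, \<beta>, 0], vector [-s, 0, t]]
        | V5 \<Rightarrow> vector [vector [t, s, 0], vector [s, t, 0], vector [0, 0, \<beta>]]
        | V6 \<Rightarrow> vector [vector [t, -s, 0], vector [-s, t, 0], vector [0, 0, \<beta>]])"

fun distinguished_axis :: "variant \<Rightarrow> 3"
  where
    "distinguished_axis V1 = 1"
  | "distinguished_axis V2 = 1"
  | "distinguished_axis V3 = 2"
  | "distinguished_axis V4 = 2"
  | "distinguished_axis V5 = 3"
  | "distinguished_axis V6 = 3"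

definition compound_counterpart :: "variant \<Rightarrow> variant \<Rightarrow> bool"
  where "compound_counterpart I J \<longleftrightarrow> J \<noteq> I \<and> distinguished_axis J = distinguished_axis I"

definition rotation_pi :: "real^3 \<Rightarrow> real^3^3"
  where "rotation_pi p = - mat 1 + 2 *\<^sub>R (p \<otimes> p)"

text \<open>
  The vector \<open>p\<close> is determined only up to sign; this is immaterial below, where only the line
  spanned by \<open>p\<close> matters.
\<close>

definition twin_axis :: "real \<Rightarrow> real \<Rightarrow> real \<Rightarrow> variant \<Rightarrow> variant \<Rightarrow> real^3 \<Rightarrow> bool"
  where
    "twin_axis \<alpha> \<beta> \<gamma> I J p \<longleftrightarrow>
      (let e = (\<lambda>V. axis (distinguished_axis V) 1) in
        norm p = 1 \<and>
        (p = (1 / sqrt 2) *\<^sub>R (e I + e J) \<or> p = (1 / sqrt 2) *\<^sub>R (e I - e J)) \<and>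
        variant_matrix \<alpha> \<beta> \<gamma> J = rotation_pi p ** variant_matrix \<alpha> \<beta> \<gamma> I ** rotation_pi p)"

definition type_II_twin ::
    "real \<Rightarrow> real \<Rightarrow> real \<Rightarrow> variant \<Rightarrow> variant \<Rightarrow> real^3^3 \<Rightarrow> real^3 \<Rightarrow> real^3 \<Rightarrow> bool"
  where
    "type_II_twin \<alpha> \<beta> \<gamma> I J R b n \<longleftrightarrow>
      distinguished_axis I \<noteq> distinguished_axis J \<and>
      rotation_matrix R \<and> b \<noteq> 0 \<and> n \<noteq> 0 \<and>
      R ** variant_matrix \<alpha> \<beta> \<gamma> J - variant_matrix \<alpha> \<beta> \<gamma> I = b \<otimes> n \<and>
      (\<exists>p c. twin_axis \<alpha> \<beta> \<gamma> I J p \<and> b = c *\<^sub>R (variant_matrix \<alpha> \<beta> \<gamma> I *v p))"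

end

theory Submission
  imports Defs
begin

text \<open>
  Write \<open>U = U\<^sub>A\<close>, \<open>V = U\<^sup>-\<^sup>1\<close>, \<open>b \<otimes> n\<close> for the Type-II twin \<open>A, B\<close> with axis \<open>p\<close>, and \<open>d \<otimes> m\<close> for
  the compound twin \<open>A, A'\<close>. The equality of the normals of the two compound twins forces \<open>m\<close> to be the
  third coordinate axis, so \<open>m \<bottom> p\<close> and the half-turn about \<open>m\<close> exchanges compound counterparts.
  A rotation of the form \<open>- 1 + w \<otimes> v\<close> is a half-turn with \<open>w\<close> parallel to \<open>v\<close>; applied to
  \<open>R\<^sub>A\<^sub>B P\<close> and \<open>R\<^sub>A\<^sub>A\<^sub>' N\<close>, where \<open>P\<close> and \<open>N\<close> are the half-turns about \<open>p\<close> and \<open>m\<close>, this yields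
  \<open>\<eta> = 2 n \<bullet> m\<close> and \<open>R\<^sub>A\<^sub>B b\<^sub>B\<^sub>B\<^sub>' = d - \<eta> b\<close>, hence
  \<open>M(\<lambda>, \<Lambda>) = U + \<lambda> b \<otimes> n + \<Lambda> d \<otimes> m - \<eta> \<lambda> \<Lambda> b \<otimes> m\<close>.
  From this form \<open>M(1 - \<lambda>, \<Lambda>) P = (R\<^sub>A\<^sub>B P) M(\<lambda>, \<Lambda>)\<close> and \<open>M(\<lambda>, 1 - \<Lambda>) N = (R\<^sub>A\<^sub>A\<^sub>' N) M(\<lambda>, \<Lambda>)\<close>,
  so \<open>g\<close> is symmetric about \<open>1/2\<close> in each variable. Moreover
  \<open>g(\<lambda>, \<Lambda>) = det (A\<^sub>0 + \<lambda> A\<^sub>1 + \<Lambda> A\<^sub>2 + \<lambda> \<Lambda> A\<^sub>3)\<close> is cubic in each variable; the symmetry removes the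
  cubic terms and the coefficients are read off from derivatives at \<open>0\<close> and values at \<open>1/2\<close>.
\<close>

section \<open>Linear algebra of rank-one and symmetric matrices\<close>

lemma outer_mult_vec: "(a \<otimes> b) *v x = (b \<bullet> x) *\<^sub>R a"
  by (simp add: outer_def vec_eq_iff matrix_vector_mult_def inner_vec_def sum_distrib_left mult_ac)

lemma matrix_mult_outer: "X ** (a \<otimes> b) = (X *v a) \<otimes> b"
  by (simp add: outer_def vec_eq_iff matrix_matrix_mult_def matrix_vector_mult_def
      sum_distrib_left mult_ac)

lemma uminus_matrix_vector: "(- X) *v x = - (X *v x :: real^3)"
  by (simp add: vec_eq_iff matrix_vector_mult_def sum_negf)

lemma matrix_vector_uminus: "X *v (- x) = - (X *v x :: real^3)"
  by (simp add: vec_eq_iff matrix_vector_mult_def sum_negf)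

lemma scaleR_matrix_vector: "(r *\<^sub>R X) *v x = r *\<^sub>R (X *v x :: real^3)"
  by (simp add: vec_eq_iff matrix_vector_mult_def sum_distrib_left mult_ac)

lemmas matrix_vector_linear = matrix_vector_mult_add_rdistrib matrix_vector_mult_diff_rdistrib
  uminus_matrix_vector scaleR_matrix_vector vec.add vec.diff matrix_vector_uminus
  matrix_vector_mult_scaleR outer_mult_vec inner_add_left inner_add_right inner_diff_left
  inner_diff_right inner_minus_left inner_minus_right

lemma inner_matrix_vector_symmetric:
  assumes "transpose X = (X :: real^3^3)"
  shows "x \<bullet> (X *v y) = (X *v x) \<bullet> y"
  by (metis assms dot_lmul_matrix vector_transpose_matrix)

lemma transpose_outer: "transpose (a \<otimes> b) = b \<otimes> a"
  by (simp add: outer_def transpose_def vec_eq_iff)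

lemma transpose_linear:
  "transpose (X + Y) = transpose X + transpose (Y :: real^3^3)"
  "transpose (X - Y) = transpose X - transpose Y"
  "transpose (- X) = - transpose X"
  by (simp_all add: transpose_def vec_eq_iff)

lemma outer_linear:
  "(a + a') \<otimes> b = a \<otimes> b + a' \<otimes> b" "a \<otimes> (b + b') = a \<otimes> b + a \<otimes> b'"
  "(a - a') \<otimes> b = a \<otimes> b - a' \<otimes> b" "a \<otimes> (b - b') = a \<otimes> b - a \<otimes> b'"
  "(r *\<^sub>R a) \<otimes> b = r *\<^sub>R (a \<otimes> b)" "a \<otimes> (r *\<^sub>R b) = r *\<^sub>R (a \<otimes> b)"
  "(- a) \<otimes> b = - (a \<otimes> b)" "a \<otimes> (- b) = - (a \<otimes> b)"
  "0 \<otimes> b = 0" "a \<otimes> 0 = 0"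
  by (simp_all add: outer_def vec_eq_iff algebra_simps)

lemma det_one_plus_outer: "det (mat 1 + a \<otimes> b) = 1 + a \<bullet> b"
  by (simp add: det_3 mat_def outer_def inner_vec_def sum_3 algebra_simps)

lemma det_minus_3: "det (- X) = - det (X :: real^3^3)"
  by (simp add: det_3)

lemma matrix_inner_linear:
  "matrix_inner X (Y + Z) = matrix_inner X Y + matrix_inner X Z"
  "matrix_inner (X + Y) Z = matrix_inner X Z + matrix_inner Y Z"
  "matrix_inner (X - Y) Z = matrix_inner X Z - matrix_inner Y Z"
  "matrix_inner X (r *\<^sub>R Y) = r * matrix_inner X Y"
  "matrix_inner (r *\<^sub>R X) Y = r * matrix_inner X Y"
  by (simp_all add: matrix_inner_def trace_def matrix_matrix_mult_def transpose_def sum_3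
      algebra_simps)

lemma matrix_inner_outer: "matrix_inner X (a \<otimes> b) = a \<bullet> (X *v b)"
  by (simp add: matrix_inner_def trace_def matrix_matrix_mult_def matrix_vector_mult_def
      transpose_def outer_def inner_vec_def sum_3 algebra_simps)

section \<open>Determinant and cofactor matrix as polynomials\<close>

lemma cof_mult_transpose: "transpose X ** cof X = det X *\<^sub>R mat 1"
  by (simp add: vec_eq_iff forall_3 cof_def matrix_matrix_mult_def sum_3 det_3 transpose_def
      mat_def algebra_simps)

lemma transpose_cof: "transpose (cof X) = cof (transpose X)"
  by (simp add: vec_eq_iff forall_3 cof_def det_3 transpose_def algebra_simps)

text \<open>\<open>cof X\<close> is the gradient of \<open>det\<close> at \<open>X\<close>. The
  quadratic coefficient is the linear one with \<open>X\<close> and \<open>Y\<close> exchanged, by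
  homogeneity.\<close>

lemma det_add_scaleR:
  "det (X + r *\<^sub>R Y) =
    det X + r * matrix_inner (cof X) Y + r\<^sup>2 * matrix_inner (cof Y) X + r^3 * det Y"
  by (simp add: cof_def matrix_inner_def trace_def matrix_matrix_mult_def transpose_def sum_3
      det_3 algebra_simps power2_eq_square power3_eq_cube)

text \<open>\<open>cof\<close> is a quadratic map in dimension three; the middle coefficient is its
  polarisation.\<close>

lemma cof_add_scaleR:
  "cof (X + r *\<^sub>R Y) = cof X + r *\<^sub>R (cof (X + Y) - cof X - cof Y) + r\<^sup>2 *\<^sub>R cof Y"
  by (simp add: vec_eq_iff forall_3 cof_def det_3 algebra_simps power2_eq_square)

text \<open>Comparing values at 0 and 1, and at -1 and 2, forces \<open>c3 = 0\<close> and
  \<open>c2 = - c1\<close>. The second form recovers \<open>c1\<close> from the value at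
  \<open>1/2\<close>, where \<open>r\<^sup>2 - r\<close> equals \<open>-1/4\<close>.\<close>

lemma cubic_reflection_symmetric:
  fixes c0 c1 c2 c3 r :: real
  assumes "\<And>r. f r = c0 + c1 * r + c2 * r\<^sup>2 + c3 * r^3" and "\<And>r. f (1 - r) = f r"
  shows "f r = c0 - c1 * (r\<^sup>2 - r)" "f r = f 0 - 4 * (f (1/2) - f 0) * (r\<^sup>2 - r)"
proof -
  have "f 1 = f 0" "f 2 = f (-1)"
    using assms(2)[of 0] assms(2)[of "-1"] by simp_all
  then have c: "c1 + c2 + c3 = 0" "3 * c1 + 3 * c2 + 9 * c3 = 0"
    by (simp_all add: assms(1))
  then have "c3 = 0" "c2 = - c1"
    by simp_all
  then show "f r = c0 - c1 * (r\<^sup>2 - r)" "f r = f 0 - 4 * (f (1/2) - f 0) * (r\<^sup>2 - r)"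
    by (simp_all add: assms(1) algebra_simps power2_eq_square)
qed

section \<open>Half-turns and the rotation in a twin relation\<close>

text \<open>Determinant one means \<open>w \<bullet> v = 2\<close>. Applying the transpose of the
  rotation to the image of \<open>v\<close> must return \<open>v\<close>, which makes
  \<open>w\<close> parallel to \<open>v\<close>; the inner product then fixes the factor.\<close>

lemma rotation_minus_one_plus_outer:
  assumes rot: "rotation_matrix (- mat 1 + w \<otimes> v)"
  shows "v \<noteq> 0" "w = (2 / (v \<bullet> v)) *\<^sub>R v"
proof -
  let ?S = "- mat 1 + w \<otimes> v"
  have "- ?S = mat 1 + (- w) \<otimes> v"
    by (simp add: outer_linear)
  then have "det ?S = w \<bullet> v - 1"
    using det_one_plus_outer[of "- w" v] det_minus_3[of ?S] by (metis add.inverse_inverse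
        inner_minus_left minus_add_distrib uminus_add_conv_diff add.commute)
  then have wv: "w \<bullet> v = 2"
    using rot by (simp add: rotation_matrix_def)
  then show v: "v \<noteq> 0"
    by auto
  have "(- mat 1 + v \<otimes> w) ** ?S = mat 1"
    using rot by (simp add: rotation_matrix_def orthogonal_matrix transpose_linear transpose_outer)
  then have "(- mat 1 + v \<otimes> w) *v (?S *v v) = v"
    by (simp add: matrix_vector_mul_assoc)
  then have "(v \<bullet> v) *\<^sub>R w = ((w \<bullet> w) * (v \<bullet> v) - 2) *\<^sub>R v"
    using wv by (simp add: matrix_vector_linear algebra_simps)
  then have "w = (((w \<bullet> w) * (v \<bullet> v) - 2) / (v \<bullet> v)) *\<^sub>R v"
    using v by (simp add: eq_vector_fraction_iff)
  then obtain k where k: "w = k *\<^sub>R v" ..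
  with wv v have "k = 2 / (v \<bullet> v)"
    by (simp add: field_simps)
  with k show "w = (2 / (v \<bullet> v)) *\<^sub>R v"
    by simp
qed

lemma rotation_pi_vec: "rotation_pi p *v x = - x + (2 * (p \<bullet> x)) *\<^sub>R p"
  by (simp add: rotation_pi_def matrix_vector_linear)

lemma transpose_rotation_pi: "transpose (rotation_pi p) = rotation_pi p"
  by (simp add: rotation_pi_def transpose_def outer_def mat_def vec_eq_iff)

lemma rotation_pi_involution:
  assumes "norm p = 1"
  shows "rotation_pi p ** rotation_pi p = mat 1"
proof -
  have "p \<bullet> p = 1"
    using assms by (simp add: dot_square_norm)
  then show ?thesis
    by (simp add: matrix_eq rotation_pi_vec inner_add_right inner_diff_right
        flip: matrix_vector_mul_assoc scaleR_left_distrib)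
qed

lemma rotation_matrix_rotation_pi:
  assumes "norm p = 1"
  shows "rotation_matrix (rotation_pi p)"
proof -
  have "- rotation_pi p = mat 1 + ((- 2) *\<^sub>R p) \<otimes> p"
    by (simp add: rotation_pi_def outer_linear)
  then have "det (rotation_pi p) = 1"
    using det_one_plus_outer[of "(- 2) *\<^sub>R p" p] det_minus_3[of "rotation_pi p"] assms
    by (simp add: dot_square_norm)
  then show ?thesis
    using rotation_pi_involution[OF assms]
    by (simp add: rotation_matrix_def orthogonal_matrix transpose_rotation_pi)
qed

lemma rotation_matrix_mult:
  "rotation_matrix R \<Longrightarrow> rotation_matrix S \<Longrightarrow> rotation_matrix (R ** S :: real^3^3)"
  by (simp add: rotation_matrix_def orthogonal_matrix_mul det_mul)

lemma inverse_symmetric: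
  assumes "transpose U = (U :: real^3^3)" "U ** V = mat 1"
  shows "V ** U = mat 1" "transpose V = V"
proof -
  show VU: "V ** U = mat 1"
    using assms(2) by (metis matrix_left_right_inverse)
  have "transpose V ** U = mat 1"
    using assms by (metis matrix_transpose_mul transpose_mat)
  then show "transpose V = V"
    by (metis assms(2) matrix_mul_assoc matrix_mul_lid matrix_mul_rid)
qed

lemma matrix_diff_distrib:
  "(X - Y) ** Z = X ** Z - Y ** (Z :: real^3^3)" "Z ** (X - Y) = Z ** X - Z ** (Y :: real^3^3)"
  by (simp_all add: matrix_matrix_mult_def vec_eq_iff algebra_simps sum_subtractf)

text \<open>With \<open>P\<close> the half-turn, \<open>U' P V = P\<close>, hence
  \<open>R P = (R U') P V\<close>, and the twin relation gives
  \<open>R U' = U + b \<otimes> n\<close>. For both twin types the rank-one terms will merge into a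
  single one.\<close>

lemma twin_rotation_eq:
  assumes U: "transpose U = U" and UV: "U ** V = mat 1"
    and p: "norm p = 1" and U': "U' = rotation_pi p ** U ** rotation_pi p"
    and twin: "R ** U' - U = b \<otimes> n"
  shows "R ** rotation_pi p =
    - mat 1 + (2 *\<^sub>R (U *v p)) \<otimes> (V *v p) - b \<otimes> (V *v n) + (2 * (n \<bullet> p)) *\<^sub>R (b \<otimes> (V *v p))"
proof -
  let ?P = "rotation_pi p"
  note V = inverse_symmetric(2)[OF U UV]
  have PP: "?P *v (?P *v x) = x" for x
    using rotation_pi_involution[OF p] by (metis matrix_vector_mul_assoc matrix_vector_mul_lid)
  have UVx: "U *v (V *v x) = x" for x
    using UV by (metis matrix_vector_mul_assoc matrix_vector_mul_lid)
  have "(R ** ?P) *v x = R *v (U' *v (?P *v (V *v x)))" for x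
    using UVx PP by (simp add: U' flip: matrix_vector_mul_assoc)
  also have "\<dots>x = (U + b \<otimes> n) *v (?P *v (V *v x))" for x
    using twin by (metis add.commute diff_add_cancel matrix_vector_mul_assoc)
  finally show ?thesis
    by (simp add: matrix_eq matrix_vector_linear rotation_pi_vec UVx
       inner_matrix_vector_symmetric[OF V] algebra_simps)
qed

section \<open>Gram determinants: invariance, reduction to a cubic, coefficients\<close>

text \<open>The left rotation \<open>S\<close> cancels in the Gram matrix and \<open>P\<close> acts
  by conjugation, which fixes the identity and the determinant.\<close>

lemma det_gram_conjugate:
  fixes F F' :: "real^3^3"
  assumes "F' ** P = S ** F" "rotation_matrix P" "rotation_matrix S"
  shows "det (transpose F' ** F' - mat 1) = det (transpose F ** F - mat 1)"
proof -
  have P: "transpose P ** P = mat 1" "P ** transpose P = mat 1" "det P = 1" and S: "transpose S ** S = mat 1"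
    using assms by (simp_all add: rotation_matrix_def orthogonal_matrix_def)
  have "transpose P ** (transpose F' ** F' - mat 1) ** P = transpose (F' ** P) ** (F' ** P) - mat 1"
    by (simp add: matrix_transpose_mul matrix_mul_assoc matrix_diff_distrib P)
  also have "\<dots> = transpose F ** (transpose S ** S) ** F - mat 1"
    by (simp add: assms(1) matrix_transpose_mul matrix_mul_assoc)
  finally have "transpose P ** (transpose F' ** F' - mat 1) ** P = transpose F ** F - mat 1"
    by (simp add: S)
  then show ?thesis
    using P by (metis det_mul det_transpose mult_1 mult.right_neutral)
qed

text \<open>Both summands contribute equally: for \<open>?A = U\<^sup>2 - 1\<close>, the vector
  \<open>?A *v (C *v n)\<close> is a multiple of \<open>n\<close>, hence orthogonal to
  \<open>V *v b\<close>, and expanding \<open>?A\<close> equates the two contributions. This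
  produces the form of \<open>a\<^sub>1\<close> and \<open>a\<^sub>2\<close>.\<close>

lemma matrix_inner_cof_twin:
  fixes U V :: "real^3^3"
  assumes U: "transpose U = U" and UV: "U ** V = mat 1" and n: "n \<bullet> (V *v b) = 0"
  defines "C \<equiv> cof (U ** U - mat 1)"
  shows "matrix_inner C ((U *v b) \<otimes> n + n \<otimes> (V *v b)) = 2 * (b \<bullet> ((U ** C) *v n))"
proof -
  let ?A = "U ** U - mat 1"
  have V: "transpose V = V" and UVx: "U *v (V *v x) = x" for x
    using inverse_symmetric[OF U UV] UV by (simp_all add: matrix_vector_mul_assoc)
  have A: "transpose ?A = ?A"
    by (simp add: transpose_linear matrix_transpose_mul U)
  then have C: "transpose C = C"
    by (simp add: C_def transpose_cof)
  have "?A *v (C *v n) = det ?A *\<^sub>R n"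
    using cof_mult_transpose[of ?A] A
    by (simp add: matrix_vector_mul_assoc C_def scaleR_matrix_vector)
  then have "(?A *v (C *v n)) \<bullet> (V *v b) = 0"
    by (simp add: n)
  then have "(C *v n) \<bullet> (V *v b) = (U *v (C *v n)) \<bullet> b"
    using UVx[of b]
    by (simp add: matrix_vector_linear flip: matrix_vector_mul_assoc inner_matrix_vector_symmetric[OF U])
  moreover have "n \<bullet> (C *v (V *v b)) = (C *v n) \<bullet> (V *v b)"
    by (rule inner_matrix_vector_symmetric[OF C])
  moreover have "(U *v b) \<bullet> (C *v n) = b \<bullet> (U *v (C *v n))"
    by (rule inner_matrix_vector_symmetric[OF U, symmetric])
  ultimately show ?thesis
    by (simp add: matrix_inner_linear matrix_inner_outer inner_commute[of _ b]
        flip: matrix_vector_mul_assoc)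
qed

lemma one_plus_outer_inverse:
  assumes "b \<bullet> a = 0"
  shows "(mat 1 - a \<otimes> b) ** (mat 1 + a \<otimes> b) = mat 1"
  using assms by (simp add: matrix_eq matrix_vector_linear flip: matrix_vector_mul_assoc)

text \<open>The Gram matrix is quadratic in each of \<open>l\<close> and \<open>L\<close>, which
  only bounds the degree of its determinant by six. Stripping a factor of determinant one leaves a
  matrix affine in each variable, so the degree is at most three.\<close>

lemma det_gram_double_laminate:
  fixes U V :: "real^3^3" and l L \<eta> :: real
  assumes U: "transpose U = U" and UV: "U ** V = mat 1"
    and nb: "n \<bullet> (V *v b) = 0" and mb: "m \<bullet> (V *v b) = 0" and md: "m \<bullet> (V *v d) = 0"
  defines "F \<equiv> U + l *\<^sub>R (b \<otimes> n) + L *\<^sub>R (d \<otimes> m) - (\<eta> * l * L) *\<^sub>R (b \<otimes> m)"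
  shows "det (transpose F ** F - mat 1) =
    det (U ** U - mat 1 + l *\<^sub>R ((U *v b) \<otimes> n + n \<otimes> (V *v b))
      + L *\<^sub>R ((U *v d) \<otimes> m + m \<otimes> (V *v d))
      + (l * L) *\<^sub>R (- ((((V *v n) \<bullet> d) + \<eta>) *\<^sub>R (m \<otimes> (V *v b))) - \<eta> *\<^sub>R ((U *v b) \<otimes> m)))"
    (is "_ = det ?A")
proof -
  define a c k where "a = L *\<^sub>R (V *v d)" and "c = l *\<^sub>R (V *v b)" and "k = n - (\<eta> * L) *\<^sub>R m"
  \<comment> \<open>\<open>F = U X\<close> with \<open>det X = 1\<close> and \<open>Y = X\<^sup>-\<^sup>1\<close>, hence \<open>F\<^sup>T F - 1 = X\<^sup>T (U F - Y\<^sup>T)\<close>.\<close>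
  define X where "X = (mat 1 + a \<otimes> m) ** (mat 1 + c \<otimes> k)"
  define Y where "Y = (mat 1 - c \<otimes> k) ** (mat 1 - a \<otimes> m)"
  have V: "transpose V = V" and UVx: "U *v (V *v x) = x" for x
    using inverse_symmetric[OF U UV] UV by (simp_all add: matrix_vector_mul_assoc)
  have ma: "m \<bullet> a = 0" and kc: "k \<bullet> c = 0" and mc: "m \<bullet> c = 0"
    using nb mb md by (simp_all add: a_def c_def k_def inner_diff_left)
  \<comment> \<open>The mixed term of \<open>X\<close> vanishes because
    \<open>m \<bullet> c = 0\<close>. In the reversed product \<open>Y\<close> it survives, and
    yields the part of the \<open>l * L\<close> coefficient that contains
    \<open>(V *v n) \<bullet> d\<close>.\<close>
  have X: "X = mat 1 + a \<otimes> m + c \<otimes> k" and Y: "Y = mat 1 - a \<otimes> m - c \<otimes> k + (k \<bullet> a) *\<^sub>R (c \<otimes> m)"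
    by (simp_all add: X_def Y_def matrix_eq matrix_vector_linear mc algebra_simps flip: matrix_vector_mul_assoc)
  have UX: "U ** X = F"
    by (simp add: X F_def matrix_add_ldistrib matrix_mult_outer, simp add: a_def c_def k_def
        matrix_vector_linear UVx outer_linear algebra_simps)
  have "k \<bullet> a = L * ((V *v n) \<bullet> d)"
    using md inner_matrix_vector_symmetric[OF V, of n d] by (simp add: k_def a_def inner_diff_left)
  then have A: "?A = U ** F - transpose Y"
    by (simp add: Y F_def matrix_add_ldistrib matrix_diff_distrib matrix_mult_outer transpose_linear
        transpose_outer transpose_scalar matrix_scalar_ac,
        simp add: a_def c_def k_def outer_linear matrix_vector_linear algebra_simps)
  have "Y ** X = (mat 1 - c \<otimes> k) ** ((mat 1 - a \<otimes> m) ** (mat 1 + a \<otimes> m)) ** (mat 1 + c \<otimes> k)"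
    by (simp add: X_def Y_def matrix_mul_assoc)
  then have "Y ** X = mat 1"
    by (simp add: one_plus_outer_inverse ma kc)
  then have XY: "transpose X ** transpose Y = mat 1"
    by (simp flip: matrix_transpose_mul)
  have "transpose X ** ?A = transpose X ** U ** F - mat 1"
    unfolding A matrix_diff_distrib XY by (simp only: matrix_mul_assoc)
  also have "transpose X ** U = transpose F"
    by (metis U UX matrix_transpose_mul)
  finally have "transpose X ** ?A = transpose F ** F - mat 1" .
  moreover have "det X = 1"
    by (simp add: X_def det_mul det_one_plus_outer inner_commute[of a m] inner_commute[of c k] ma kc)
  then have "det (transpose X ** ?A) = det ?A"
    unfolding det_mul det_transpose by simp
  ultimately show ?thesis
    by (simp only:)
qed

text \<open>For fixed \<open>L\<close> the determinant is a cubic in \<open>l\<close>, so symmetry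
  makes it affine in \<open>l\<^sup>2 - l\<close>. Its constant term and slope are again symmetric
  cubics, now in \<open>L\<close>. The constant term is expanded by its derivative at 0, the slope
  by its values at 0 and \<open>1/2\<close>; hence the halves in the last coefficient.\<close>

lemma double_symmetric_det:
  fixes X A\<^sub>1 A\<^sub>2 A\<^sub>3 :: "real^3^3"
  defines "G \<equiv> \<lambda>l L. det (X + l *\<^sub>R A\<^sub>1 + L *\<^sub>R A\<^sub>2 + (l * L) *\<^sub>R A\<^sub>3)"
  assumes sym_l: "\<And>l L. G (1 - l) L = G l L" and sym_L: "\<And>l L. G l (1 - L) = G l L"
  shows "G l L = det X - matrix_inner (cof X) A\<^sub>1 * (l\<^sup>2 - l) - matrix_inner (cof X) A\<^sub>2 * (L\<^sup>2 - L)
    + (4 * matrix_inner (cof (X + (1/2) *\<^sub>R A\<^sub>2)) (A\<^sub>1 + (1/2) *\<^sub>R A\<^sub>3) - 4 * matrix_inner (cof X) A\<^sub>1)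
      * (l\<^sup>2 - l) * (L\<^sup>2 - L)"
proof -
  define h where "h L = matrix_inner (cof (X + L *\<^sub>R A\<^sub>2)) (A\<^sub>1 + L *\<^sub>R A\<^sub>3)" for L
  have G: "G l L = det (X + L *\<^sub>R A\<^sub>2) - h L * (l\<^sup>2 - l)" for l L
  proof (rule cubic_reflection_symmetric(1))
    have "G l L = det ((X + L *\<^sub>R A\<^sub>2) + l *\<^sub>R (A\<^sub>1 + L *\<^sub>R A\<^sub>3))" for l
      unfolding G_def by (rule arg_cong[where f = det]) (simp add: algebra_simps)
    then show "G l L = det (X + L *\<^sub>R A\<^sub>2) + h L * l +
        matrix_inner (cof (A\<^sub>1 + L *\<^sub>R A\<^sub>3)) (X + L *\<^sub>R A\<^sub>2) * l\<^sup>2 + det (A\<^sub>1 + L *\<^sub>R A\<^sub>3) * l ^ 3" for l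
      unfolding h_def det_add_scaleR[of "X + L *\<^sub>R A\<^sub>2"] by (simp only: mult.commute)
  qed (rule sym_l)
  have G0: "G 0 L = det X - matrix_inner (cof X) A\<^sub>2 * (L\<^sup>2 - L)" for L
    by (rule cubic_reflection_symmetric(1)[where f = "G 0"])
      (simp_all add: sym_L, simp add: G_def det_add_scaleR mult.commute)
  have h: "h L = h 0 - 4 * (h (1/2) - h 0) * (L\<^sup>2 - L)" for L
  proof (rule cubic_reflection_symmetric(2))
    let ?D = "cof (X + A\<^sub>2) - cof X - cof A\<^sub>2"
    show "h L = matrix_inner (cof X) A\<^sub>1 + (matrix_inner (cof X) A\<^sub>3 + matrix_inner ?D A\<^sub>1) * L
      + (matrix_inner ?D A\<^sub>3 + matrix_inner (cof A\<^sub>2) A\<^sub>1) * L\<^sup>2 + matrix_inner (cof A\<^sub>2) A\<^sub>3 * L ^ 3" for L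
      unfolding h_def cof_add_scaleR[of X L]
      by (simp add: matrix_inner_linear algebra_simps power2_eq_square power3_eq_cube)
    show "h (1 - L) = h L" for L
      \<comment> \<open>At \<open>l = 0\<close> the term with \<open>h\<close> disappears, at
        \<open>l = 2\<close> it has weight 2; together they isolate \<open>h\<close>.\<close>
      using sym_L[of 2 L] sym_L[of 0 L] by (simp add: G)
  qed
  have "G l L = G 0 L - h L * (l\<^sup>2 - l)"
    by (simp add: G)
  also have "\<dots> = det X - matrix_inner (cof X) A\<^sub>2 * (L\<^sup>2 - L)
      - (h 0 - 4 * (h (1/2) - h 0) * (L\<^sup>2 - L)) * (l\<^sup>2 - l)"
    by (subst h) (simp add: G0)
  also have "h 0 = matrix_inner (cof X) A\<^sub>1"
    by (simp add: h_def)
  finally show ?thesis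
    by (simp add: h_def algebra_simps)
qed

section \<open>Variants and the normals of compound twins\<close>

lemma transpose_variant_matrix: "transpose (variant_matrix \<alpha> \<beta> \<gamma> I) = variant_matrix \<alpha> \<beta> \<gamma> I"
  by (cases I) (simp_all add: variant_matrix_def Let_def transpose_def vec_eq_iff forall_3)

lemma det_variant_matrix: "det (variant_matrix \<alpha> \<beta> \<gamma> I) = \<alpha> * \<beta> * \<gamma>"
  by (cases I) (simp_all add: variant_matrix_def Let_def det_3 field_simps)

lemma variant_matrix_axis:
  "variant_matrix \<alpha> \<beta> \<gamma> I *v axis (distinguished_axis I) 1 = \<beta> *\<^sub>R axis (distinguished_axis I) 1"
  by (cases I) (simp_all add: variant_matrix_def Let_def vec_eq_iff forall_3
      matrix_vector_mult_def sum_3 axis_def)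

lemma compound_counterpart_gram_neq:
  assumes "compound_counterpart I J" "\<alpha> > 0" "\<gamma> > 0" "\<alpha> \<noteq> \<gamma>"
  shows "variant_matrix \<alpha> \<beta> \<gamma> J ** variant_matrix \<alpha> \<beta> \<gamma> J \<noteq> variant_matrix \<alpha> \<beta> \<gamma> I ** variant_matrix \<alpha> \<beta> \<gamma> I"
proof -
  \<comment> \<open>This number is, up to sign, the difference of the off-diagonal entries
    \<open>2 t s\<close> and \<open>- 2 t s\<close> of the two squares.\<close>
  have "(\<alpha> + \<gamma>) * (\<alpha> - \<gamma>) \<noteq> 0"
    using assms by simp
  then show ?thesis
    using assms(1)
    by (cases I; cases J) (auto simp: compound_counterpart_def variant_matrix_def Let_def vec_eq_iff
        forall_3 matrix_matrix_mult_def sum_3 field_simps)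
qed

text \<open>Here \<open>m\<close> is plus or minus the remaining coordinate vector, and the sign
  drops out of \<open>m \<otimes> m\<close>.\<close>

lemma rotation_pi_axis:
  fixes i j :: 3
  assumes "norm m = 1" "i \<noteq> j" "m $ i = 0" "m $ j = 0"
  shows "rotation_pi m = (\<chi> k l. if k = l then if k = i \<or> k = j then -1 else 1 else 0)"
proof -
  have "m $ 1 * m $ 1 + m $ 2 * m $ 2 + m $ 3 * m $ 3 = 1"
    using assms(1) by (simp add: norm_eq_1 inner_vec_def sum_3)
  then have m: "m $ k * m $ k = 1" if "k \<noteq> i" "k \<noteq> j" for k
    using that assms(2-4) exhaust_3[of i] exhaust_3[of j] exhaust_3[of k] by force
  have m0: "m $ k = 0 \<or> m $ l = 0" if "l \<noteq> k" for k l
    using that assms(2-4) exhaust_3[of i] exhaust_3[of j] exhaust_3[of k] exhaust_3[of l] by force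
  show ?thesis
    unfolding vec_eq_iff
  proof (intro allI)
    fix k l
    show "rotation_pi m $ k $ l = (\<chi> k l. if k = l then if k = i \<or> k = j then - 1 else 1 else 0) $ k $ l"
      using m[of k] m0[of k l] assms(3,4) by (auto simp: rotation_pi_def outer_def mat_def)
  qed
qed

text \<open>The half-turn is diagonal with opposite signs on the two axes other than the
  distinguished one, so conjugation reverses exactly the off-diagonal entry
  \<open>s\<close>.\<close>

lemma compound_counterpart_rotation_pi:
  assumes "compound_counterpart I J" "norm m = 1" "m $ distinguished_axis I = 0"
    and "j \<noteq> distinguished_axis I" "m $ j = 0"
  shows "variant_matrix \<alpha> \<beta> \<gamma> J = rotation_pi m ** variant_matrix \<alpha> \<beta> \<gamma> I ** rotation_pi m"
  unfolding rotation_pi_axis[OF assms(2,4,5,3)]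
  using assms(1,4) exhaust_3[of j]
  by (cases I; cases J; elim disjE; simp add: compound_counterpart_def;
     simp add: variant_matrix_def Let_def vec_eq_iff
        forall_3 matrix_matrix_mult_def sum_3 diff_divide_distrib)

text \<open>\<open>R\<close> cancels in the square of \<open>R U' = U + b \<otimes> n\<close>. The
  term in \<open>n \<otimes> n\<close> is split evenly so that the difference becomes a symmetrised
  product of \<open>n\<close> with one vector.\<close>

lemma twin_gram:
  assumes "orthogonal_matrix R" "R ** U' - U = b \<otimes> n" "transpose U = U" "transpose U' = U'"
  shows "U' ** U' - U ** U = n \<otimes> (U *v b + (b \<bullet> b / 2) *\<^sub>R n) + (U *v b + (b \<bullet> b / 2) *\<^sub>R n) \<otimes> n"
proof -
  have "U' ** U' = transpose (R ** U') ** (R ** U')"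
    using assms(1,4) by (metis matrix_mul_assoc matrix_mul_lid matrix_transpose_mul orthogonal_matrix)
  also have "R ** U' = U + b \<otimes> n"
    using assms(2) by (metis add.commute diff_add_cancel)
  finally have "U' ** U' - U ** U = (n \<otimes> (U *v b) + (U *v b) \<otimes> n) + (b \<bullet> b) *\<^sub>R (n \<otimes> n)"
    by (simp add: matrix_eq transpose_linear transpose_outer assms(3) matrix_vector_linear algebra_simps
        inner_matrix_vector_symmetric[OF assms(3)] flip: matrix_vector_mul_assoc)
  also have "(b \<bullet> b) *\<^sub>R (n \<otimes> n) = (b \<bullet> b / 2) *\<^sub>R (n \<otimes> n) + (b \<bullet> b / 2) *\<^sub>R (n \<otimes> n)"
    by (simp flip: scaleR_left_distrib)
  finally show ?thesis
    by (simp add: outer_linear)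
qed

text \<open>Otherwise \<open>D *v e = 0\<close> makes \<open>w\<close> a multiple of
  \<open>n\<close>, so \<open>D\<close> is a multiple of \<open>n \<otimes> n\<close>; as this must
  kill \<open>e\<close>, the multiple is zero.\<close>

lemma symmetric_rank_two_kernel:
  assumes D: "D = n \<otimes> w + w \<otimes> n" "D *v e = 0" "D \<noteq> 0"
  shows "n \<bullet> e = 0"
proof (rule ccontr)
  assume ne: "n \<bullet> e \<noteq> 0"
  have De: "(w \<bullet> e) *\<^sub>R n + (n \<bullet> e) *\<^sub>R w = 0"
    using D(2) by (simp add: D(1) matrix_vector_linear)
  then have "(n \<bullet> e) *\<^sub>R w = (- (w \<bullet> e)) *\<^sub>R n"
    by (simp add: add_eq_0_iff)
  then have "(1 / (n \<bullet> e)) *\<^sub>R ((n \<bullet> e) *\<^sub>R w) = (1 / (n \<bullet> e)) *\<^sub>R ((- (w \<bullet> e)) *\<^sub>R n)"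
    by simp
  then have "w = (1 / (n \<bullet> e) * - (w \<bullet> e)) *\<^sub>R n"
    unfolding scaleR_scaleR using ne by simp
  then obtain k where w: "w = k *\<^sub>R n" ..
  have "(2 * k * (n \<bullet> e)) *\<^sub>R n = 0"
    using De by (simp add: w flip: scaleR_left_distrib)
  with ne have "k = 0"
    by auto
  with D(1,3) w show False
    by (simp add: outer_linear)
qed

text \<open>Both variants have the distinguished axis as eigenvector for \<beta>, so it lies in the
  kernel of the difference of their squares, a nonzero symmetrised product with
  \<open>n\<close>.\<close>

lemma compound_twin_normal:
  assumes "compound_counterpart I J" "\<alpha> > 0" "\<gamma> > 0" "\<alpha> \<noteq> \<gamma>" "rotation_matrix R"
    and twin: "R ** variant_matrix \<alpha> \<beta> \<gamma> J - variant_matrix \<alpha> \<beta> \<gamma> I = b \<otimes> n"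
  shows "n $ distinguished_axis I = 0"
proof -
  let ?U = "variant_matrix \<alpha> \<beta> \<gamma>" and ?e = "axis (distinguished_axis I) 1 :: real^3"
  have axis_J: "distinguished_axis J = distinguished_axis I"
    using assms(1) by (simp add: compound_counterpart_def)
  have "(?U J ** ?U J - ?U I ** ?U I) *v ?e = 0"
    using variant_matrix_axis[of \<alpha> \<beta> \<gamma> I] variant_matrix_axis[of \<alpha> \<beta> \<gamma> J]
    by (simp add: axis_J matrix_vector_linear flip: matrix_vector_mul_assoc)
  moreover have "?U J ** ?U J - ?U I ** ?U I \<noteq> 0"
    using compound_counterpart_gram_neq assms(1-4) by simp
  moreover have "orthogonal_matrix R"
    using assms(5) by (simp add: rotation_matrix_def)
  ultimately have "n \<bullet> ?e = 0"
    using symmetric_rank_two_kernel twin_gram[OF _ twin] transpose_variant_matrix by blast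
  then show ?thesis
    by (simp add: inner_axis)
qed

section \<open>Rotations and shear vectors of Type-I and Type-II twins\<close>

text \<open>When the normal is the half-turn axis, all rank-one terms of
  \<open>twin_rotation_eq\<close> share the right factor \<open>V *v m\<close>, so
  \<open>rotation_minus_one_plus_outer\<close> applies. Compound twins are treated as twins of this
  kind.\<close>

lemma type_I_twin:
  assumes U: "transpose U = U" and UV: "U ** V = mat 1"
    and m: "norm m = 1" and U': "U' = rotation_pi m ** U ** rotation_pi m"
    and twin: "R ** U' - U = d \<otimes> m" and R: "rotation_matrix R"
  shows "V *v m \<noteq> 0" "2 *\<^sub>R (U *v m) + d = (2 / ((V *v m) \<bullet> (V *v m))) *\<^sub>R (V *v m)"
    "R ** rotation_pi m = - mat 1 + (2 *\<^sub>R (U *v m) + d) \<otimes> (V *v m)"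
proof -
  have "m \<bullet> m = 1"
    using m by (simp add: dot_square_norm)
  then show RN: "R ** rotation_pi m = - mat 1 + (2 *\<^sub>R (U *v m) + d) \<otimes> (V *v m)"
    unfolding twin_rotation_eq[OF U UV m U' twin] by (simp add: scaleR_2 outer_linear)
  have "rotation_matrix (- mat 1 + (2 *\<^sub>R (U *v m) + d) \<otimes> (V *v m))"
    unfolding RN[symmetric] using R rotation_matrix_rotation_pi[OF m] by (rule rotation_matrix_mult)
  then show "V *v m \<noteq> 0" "2 *\<^sub>R (U *v m) + d = (2 / ((V *v m) \<bullet> (V *v m))) *\<^sub>R (V *v m)"
    by (rule rotation_minus_one_plus_outer)+
qed

text \<open>Dual to the Type-I case: since \<open>b\<close> is parallel to \<open>U *v p\<close>,
  all rank-one terms share the left factor \<open>b\<close>.\<close>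

lemma type_II_twin_rotation:
  assumes U: "transpose U = U" and UV: "U ** V = mat 1"
    and p: "norm p = 1" and U': "U' = rotation_pi p ** U ** rotation_pi p"
    and twin: "R ** U' - U = b \<otimes> n" and R: "rotation_matrix R"
    and b: "b = c *\<^sub>R (U *v p)" "b \<noteq> 0"
  shows "n \<bullet> p = 0" "(2 / (b \<bullet> b)) *\<^sub>R (U *v b) = (2 / c) *\<^sub>R p - n"
    "R ** rotation_pi p = - mat 1 + b \<otimes> ((2 / (b \<bullet> b)) *\<^sub>R b)"
proof -
  let ?P = "rotation_pi p"
  define w where "w = (2 / c + 2 * (n \<bullet> p)) *\<^sub>R (V *v p) - V *v n"
  have c: "c \<noteq> 0"
    using b by auto
  have UVx: "U *v (V *v x) = x" and VUx: "V *v (U *v x) = x" for x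
    using inverse_symmetric[OF U UV] UV by (simp_all add: matrix_vector_mul_assoc)
  have RP: "R ** ?P = - mat 1 + b \<otimes> w"
    unfolding twin_rotation_eq[OF U UV p U' twin] w_def b(1) using c
    by (simp add: matrix_eq matrix_vector_linear algebra_simps)
  have "rotation_matrix (R ** ?P)"
    using R rotation_matrix_rotation_pi[OF p] by (rule rotation_matrix_mult)
  \<comment> \<open>Transposing moves \<open>b\<close> to the right slot, so that the unknown
    \<open>w\<close> is the vector determined by the other.\<close>
  then have "rotation_matrix (transpose (R ** ?P))"
    by (simp add: rotation_matrix_def)
  also have "transpose (R ** ?P) = - mat 1 + w \<otimes> b"
    by (simp add: RP transpose_linear transpose_outer)
  finally have w: "w = (2 / (b \<bullet> b)) *\<^sub>R b"
    by (rule rotation_minus_one_plus_outer)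
  with RP show "R ** ?P = - mat 1 + b \<otimes> ((2 / (b \<bullet> b)) *\<^sub>R b)"
    by simp
  have Uw: "U *v w = (2 / c + 2 * (n \<bullet> p)) *\<^sub>R p - n"
    by (simp add: w_def matrix_vector_linear UVx)
  have "p \<bullet> p = 1"
    using p by (simp add: dot_square_norm)
  \<comment> \<open>This quantity is computed twice, from the definition of \<open>w\<close> and
    from \<open>w\<close> being parallel to \<open>b\<close>; the comparison gives
    \<open>n \<bullet> p = 0\<close>.\<close>
  then have "c * ((U *v w) \<bullet> p) = 2 + c * (n \<bullet> p)"
    using c by (simp add: Uw inner_diff_left algebra_simps)
  moreover have "c * ((U *v w) \<bullet> p) = w \<bullet> b"
    using inner_matrix_vector_symmetric[OF U, of w p] by (simp add: b(1))
  moreover have "w \<bullet> b = 2"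
    using b(2) by (simp add: w)
  ultimately show np: "n \<bullet> p = 0"
    using c by simp
  show "(2 / (b \<bullet> b)) *\<^sub>R (U *v b) = (2 / c) *\<^sub>R p - n"
    using Uw unfolding w by (simp add: np matrix_vector_mult_scaleR)
qed

text \<open>The Type-I vector \<open>2 *\<^sub>R (U *v m) + d\<close> is a multiple of
  \<open>V *v m\<close>. Pairing it with \<open>V *v m\<close> gives the first claim; pairing it
  with \<open>b\<close>, which is orthogonal to \<open>V *v m\<close>, and using the Type-II formula
  for \<open>U *v b\<close> gives the second. For the third, conjugation by the half-turn
  \<open>?P\<close> carries the first compound twin to the second, with
  \<open>e = - (?P *v d)\<close>.\<close>

lemma double_twin:
  assumes U: "transpose U = U" and UV: "U ** V = mat 1"
    and p: "norm p = 1" and W: "W = rotation_pi p ** U ** rotation_pi p"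
    and R: "rotation_matrix R" "R ** W - U = b \<otimes> n" and b: "b = c *\<^sub>R (U *v p)" "b \<noteq> 0"
    and m: "norm m = 1" "m \<bullet> p = 0"
    and U': "U' = rotation_pi m ** U ** rotation_pi m" and W': "W' = rotation_pi m ** W ** rotation_pi m"
    and Q: "rotation_matrix Q" "Q ** U' - U = d \<otimes> m"
    and S: "rotation_matrix S" "S ** W' - W = e \<otimes> m"
  defines "\<eta> \<equiv> 2 / (b \<bullet> b) * (d \<bullet> b)"
  shows "m \<bullet> (V *v d) = 0" "\<eta> = 2 * (n \<bullet> m)" "R *v e = d - \<eta> *\<^sub>R b"
proof -
  let ?P = "rotation_pi p" and ?k = "2 / ((V *v m) \<bullet> (V *v m))"
  have V: "transpose V = V" and UVx: "U *v (V *v x) = x" and VUx: "V *v (U *v x) = x" for x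
    using inverse_symmetric[OF U UV] UV by (simp_all add: matrix_vector_mul_assoc)
  have PP: "?P ** ?P = mat 1"
    by (rule rotation_pi_involution[OF p])
  have Pm: "?P *v m = - m"
    using m(2) by (simp add: rotation_pi_vec inner_commute)
  note I = type_I_twin[OF U UV m(1) U' Q(2,1)]
  note II = type_II_twin_rotation[OF U UV p W R(2,1) b]
  have "(V *v m) \<bullet> (V *v m) \<noteq> 0"
    using I(1) by simp
  then have "(2 *\<^sub>R (U *v m) + d) \<bullet> (V *v m) = 2"
    unfolding I(2) by simp
  moreover have "(U *v m) \<bullet> (V *v m) = 1"
    using inner_matrix_vector_symmetric[OF U, of m "V *v m"] m(1) by (simp add: UVx dot_square_norm)
  ultimately have "d \<bullet> (V *v m) = 0"
    by (simp add: inner_add_left)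
  then show "m \<bullet> (V *v d) = 0"
    using inner_matrix_vector_symmetric[OF V, of m d] by (simp add: inner_commute)
  have "b \<bullet> (V *v m) = 0"
    using inner_matrix_vector_symmetric[OF V, of b m] m(2) by (simp add: b(1) VUx matrix_vector_mult_scaleR inner_commute)
  then have "b \<bullet> (2 *\<^sub>R (U *v m) + d) = 0"
    unfolding I(2) by simp
  then have "d \<bullet> b = - 2 * ((U *v b) \<bullet> m)"
    using inner_matrix_vector_symmetric[OF U, of b m] by (simp add: inner_add_right inner_commute)
  then have "\<eta> = - 2 * (((2 / (b \<bullet> b)) *\<^sub>R (U *v b)) \<bullet> m)"
    by (simp add: \<eta>_def)
  also have "\<dots> = 2 * (n \<bullet> m)"
    unfolding II(2) using m(2) by (simp add: inner_diff_left inner_commute[of p m])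
  finally show "\<eta> = 2 * (n \<bullet> m)" .
  have WT: "transpose W = W"
    by (simp add: W matrix_transpose_mul transpose_rotation_pi U matrix_mul_assoc)
  have "W ** (?P ** V ** ?P) = ?P ** (U ** ((?P ** ?P) ** V)) ** ?P"
    by (simp only: W matrix_mul_assoc)
  then have WV: "W ** (?P ** V ** ?P) = mat 1"
    by (simp add: PP UV)
  have Vm: "(?P ** V ** ?P) *v m = - (?P *v (V *v m))"
    by (simp add: Pm matrix_vector_linear flip: matrix_vector_mul_assoc)
  have Wm: "W *v m = - (?P *v (U *v m))"
    by (simp add: Pm W matrix_vector_linear flip: matrix_vector_mul_assoc)
  have norm_P: "(?P *v x) \<bullet> (?P *v x) = x \<bullet> x" for x
    using inner_matrix_vector_symmetric[OF transpose_rotation_pi, of "?P *v x" p x] PP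
    by (simp add: matrix_vector_mul_assoc)
  \<comment> \<open>The Type-I identity for the second compound twin has the same factor
    \<open>?k\<close>, because \<open>?P\<close> preserves lengths.\<close>
  have "2 *\<^sub>R (W *v m) + e = - (?k *\<^sub>R (?P *v (V *v m)))"
    using type_I_twin(2)[OF WT WV m(1) W' S(2,1)] by (simp add: Vm norm_P)
  then have "e = - (?P *v (?k *\<^sub>R (V *v m) - 2 *\<^sub>R (U *v m)))"
    by (simp add: Wm matrix_vector_linear algebra_simps)
  also have "?k *\<^sub>R (V *v m) - 2 *\<^sub>R (U *v m) = d"
    using I(2) by (simp add: algebra_simps)
  finally have "R *v e = - ((R ** ?P) *v d)"
    by (simp add: matrix_vector_linear matrix_vector_mul_assoc)
  then show "R *v e = d - \<eta> *\<^sub>R b"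
    unfolding II(3) by (simp add: matrix_vector_linear \<eta>_def inner_commute)
qed

section \<open>The two reflection symmetries of the double laminate\<close>

text \<open>\<open>S\<close> fixes \<open>b\<close> and sends \<open>d\<close> to
  \<open>\<eta> b - d\<close>, while the half-turn about \<open>p\<close> reverses \<open>n\<close>
  and \<open>m\<close>. The mixed term in \<open>F\<close> absorbs the extra multiple of
  \<open>b\<close>.\<close>

lemma laminate_swap_type_II:
  fixes b d :: "real^3" and F :: "real \<Rightarrow> real \<Rightarrow> real^3^3"
  assumes "transpose U = U" and b: "b = c *\<^sub>R (U *v p)" "b \<noteq> 0"
    and np: "n \<bullet> p = 0" and mp: "m \<bullet> p = 0"
    and Ub: "(2 / (b \<bullet> b)) *\<^sub>R (U *v b) = (2 / c) *\<^sub>R p - n"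
    and S: "S = - mat 1 + b \<otimes> ((2 / (b \<bullet> b)) *\<^sub>R b)"
  defines "\<eta> \<equiv> 2 / (b \<bullet> b) * (d \<bullet> b)"
  defines "F \<equiv> \<lambda>l L. U + l *\<^sub>R (b \<otimes> n) + L *\<^sub>R (d \<otimes> m) - (\<eta> * l * L) *\<^sub>R (b \<otimes> m)"
  shows "F (1 - l) L ** rotation_pi p = S ** F l L"
proof -
  define w where "w = (2 / (b \<bullet> b)) *\<^sub>R b"
  have wb: "w \<bullet> b = 2" and wd: "w \<bullet> d = \<eta>"
    using b(2) by (simp_all add: w_def \<eta>_def inner_commute)
  have wU: "w \<bullet> (U *v x) = 2 / c * (p \<bullet> x) - n \<bullet> x" for x
    using Ub inner_matrix_vector_symmetric[OF assms(1), of w x]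
    by (simp add: w_def matrix_vector_mult_scaleR inner_diff_left)
  have Up: "U *v p = (1 / c) *\<^sub>R b"
    using b by auto
  show ?thesis
    unfolding S w_def[symmetric]
    by (simp add: matrix_eq F_def matrix_vector_linear rotation_pi_vec wb wd wU Up np mp
        algebra_simps flip: matrix_vector_mul_assoc, simp add: vec_eq_iff algebra_simps)
qed

text \<open>The roles are exchanged: \<open>T\<close> reverses \<open>b\<close> and
  \<open>d\<close>, while the half-turn about \<open>m\<close> fixes \<open>m\<close> and sends
  \<open>n\<close> to \<open>\<eta> m - n\<close>.\<close>

lemma laminate_swap_type_I:
  fixes b d :: "real^3" and F :: "real \<Rightarrow> real \<Rightarrow> real^3^3"
  assumes U: "transpose U = U" and UV: "U ** V = mat 1" and m: "norm m = 1"
    and orth: "m \<bullet> (V *v b) = 0" "m \<bullet> (V *v d) = 0" and \<eta>: "\<eta> = 2 * (n \<bullet> m)"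
    and T: "T = - mat 1 + (2 *\<^sub>R (U *v m) + d) \<otimes> (V *v m)"
  defines "F \<equiv> \<lambda>l L. U + l *\<^sub>R (b \<otimes> n) + L *\<^sub>R (d \<otimes> m) - (\<eta> * l * L) *\<^sub>R (b \<otimes> m)"
  shows "F l (1 - L) ** rotation_pi m = T ** F l L"
proof -
  have V: "transpose V = V" and VUx: "V *v (U *v x) = x" for x
    using inverse_symmetric[OF U UV] by (simp_all add: matrix_vector_mul_assoc)
  note symV = inner_matrix_vector_symmetric[OF V]
  have mm: "m \<bullet> m = 1"
    using m by (simp add: dot_square_norm)
  have Vm: "(V *v m) \<bullet> b = 0" "(V *v m) \<bullet> d = 0" "(V *v m) \<bullet> (U *v x) = m \<bullet> x" for x
    using orth symV[of m b] symV[of m d] symV[of m "U *v x"] by (simp_all add: VUx)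
  show ?thesis
    by (simp add: matrix_eq T F_def matrix_vector_linear rotation_pi_vec Vm mm \<eta>
        algebra_simps flip: matrix_vector_mul_assoc, simp add: vec_eq_iff algebra_simps)
qed

section \<open>The expansion of \<open>g\<close> and its zero set\<close>

theorem mainTheorem1:
  fixes \<alpha> \<beta> \<gamma> :: real
    and A B A' B' :: variant
    and R_AB R_A'B' R_AA' R_BB' :: "real^3^3"
    and b_AB b_A'B' b_AA' b_BB' n_AB n_A'B' n_AA' n_BB' :: "real^3"
  defines "U \<equiv> variant_matrix \<alpha> \<beta> \<gamma>"
  assumes "\<alpha> > 0" "\<beta> > 0" "\<gamma> > 0" "\<alpha> \<noteq> \<gamma>"
    and "distinguished_axis A \<noteq> distinguished_axis B"
    and "compound_counterpart A A'" "compound_counterpart B B'"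
    and "rotation_matrix R_AB" "rotation_matrix R_A'B'"
      "rotation_matrix R_AA'" "rotation_matrix R_BB'"
    and "b_AB \<noteq> 0" "b_A'B' \<noteq> 0" "b_AA' \<noteq> 0" "b_BB' \<noteq> 0"
    and "norm n_AB = 1" "norm n_A'B' = 1" "norm n_AA' = 1" "norm n_BB' = 1"
    and "R_AB ** U B - U A = b_AB \<otimes> n_AB"
    and "R_A'B' ** U B' - U A' = b_A'B' \<otimes> n_A'B'"
    and "R_AA' ** U A' - U A = b_AA' \<otimes> n_AA'"
    and "R_BB' ** U B' - U B = b_BB' \<otimes> n_BB'"
    and "type_II_twin \<alpha> \<beta> \<gamma> A B R_AB b_AB n_AB"
    and "type_II_twin \<alpha> \<beta> \<gamma> A' B' R_A'B' b_A'B' n_A'B'"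
    and "n_AA' = n_BB'"
    and "R_AB ** R_BB' = R_AA' ** R_A'B'"
  defines "M_AB \<equiv> (\<lambda>l. (1 - l) *\<^sub>R U A + l *\<^sub>R (R_AB ** U B))"
    and "M_A'B' \<equiv> (\<lambda>l. (1 - l) *\<^sub>R U A' + l *\<^sub>R (R_A'B' ** U B'))"
  defines "M \<equiv> (\<lambda>l L. (1 - L) *\<^sub>R M_AB l + L *\<^sub>R (R_AA' ** M_A'B' l))"
  defines "g \<equiv> (\<lambda>l L. det (transpose (M l L) ** M l L - mat 1))"
  defines "a\<^sub>0 \<equiv> det (U A ** U A - mat 1)"
    and "a\<^sub>1 \<equiv> -2 * (b_AB \<bullet> ((U A ** cof (U A ** U A - mat 1)) *v n_AB))"
    and "a\<^sub>2 \<equiv> -2 * (b_AA' \<bullet> ((U A ** cof (U A ** U A - mat 1)) *v n_AA'))"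
  defines "\<eta> \<equiv> 2 / (norm b_AB)\<^sup>2 * (b_AA' \<bullet> b_AB)"
  defines "A\<^sub>0 \<equiv> U A ** U A - mat 1"
    and "A\<^sub>1 \<equiv> (U A *v b_AB) \<otimes> n_AB + n_AB \<otimes> (matrix_inv (U A) *v b_AB)"
    and "A\<^sub>2 \<equiv> (U A *v b_AA') \<otimes> n_AA' + n_AA' \<otimes> (matrix_inv (U A) *v b_AA')"
    and "A\<^sub>3 \<equiv> - (((matrix_inv (U A) *v n_AB) \<bullet> b_AA' + \<eta>) *\<^sub>R (n_AA' \<otimes> (matrix_inv (U A) *v b_AB)))
               - \<eta> *\<^sub>R ((U A *v b_AB) \<otimes> n_AA')"
  defines "a\<^sub>3 \<equiv> 4 * matrix_inner (cof (A\<^sub>0 + (1 / 2) *\<^sub>R A\<^sub>2)) (A\<^sub>1 + (1 / 2) *\<^sub>R A\<^sub>3) + 4 * a\<^sub>1"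
  shows "(\<forall>l\<in>{0..1}. \<forall>L\<in>{0..1}.
            g l L = a\<^sub>0 + a\<^sub>1 * (l\<^sup>2 - l) + a\<^sub>2 * (L\<^sup>2 - L) + a\<^sub>3 * (l\<^sup>2 - l) * (L\<^sup>2 - L)) \<and>
         (a\<^sub>3 \<noteq> 0 \<and> a\<^sub>1 / a\<^sub>3 \<notin> {0..1/4} \<longrightarrow>
           (\<forall>l\<in>{0..1}. \<forall>L\<in>{0..1}.
              g l L = 0 \<longleftrightarrow> l\<^sup>2 - l = - ((a\<^sub>0 + a\<^sub>2 * (L\<^sup>2 - L)) / (a\<^sub>1 + a\<^sub>3 * (L\<^sup>2 - L)))))"
proof -
  have U: "transpose (U I) = U I" for I
    by (simp add: U_def transpose_variant_matrix)
  define V where "V = matrix_inv (U A)"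
  have "invertible (U A)"
    using assms(2-4) by (simp add: U_def invertible_det_nz det_variant_matrix)
  then have UV: "U A ** V = mat 1"
    using someI_ex[of "\<lambda>Y. U A ** Y = mat 1 \<and> Y ** U A = mat 1"]
    by (simp add: V_def matrix_inv_def invertible_def)
  obtain p c where axis_p: "twin_axis \<alpha> \<beta> \<gamma> A B p" and b: "b_AB = c *\<^sub>R (U A *v p)"
    using \<open>type_II_twin \<alpha> \<beta> \<gamma> A B R_AB b_AB n_AB\<close> unfolding type_II_twin_def U_def by blast
  then have p: "norm p = 1" and UB: "U B = rotation_pi p ** U A ** rotation_pi p"
    by (simp_all add: twin_axis_def U_def Let_def)
  have n_axis: "n_AA' $ distinguished_axis A = 0" "n_AA' $ distinguished_axis B = 0"
    using compound_twin_normal[OF assms(7,2,4,5,11)] compound_twin_normal[OF assms(8,2,4,5,12)]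
      assms(23,24,27) by (simp_all add: U_def)
  \<comment> \<open>The axis \<open>p\<close> lies in the plane of the two distinguished axes, to
    which the common normal is orthogonal.\<close>
  then have np: "n_AA' \<bullet> p = 0"
    using axis_p by (auto simp: twin_axis_def Let_def inner_add_right inner_diff_right inner_axis)
  have UA': "U A' = rotation_pi n_AA' ** U A ** rotation_pi n_AA'"
    unfolding U_def
    by (rule compound_counterpart_rotation_pi[OF assms(7,19) n_axis(1) assms(6)[symmetric] n_axis(2)])
  have UB': "U B' = rotation_pi n_AA' ** U B ** rotation_pi n_AA'"
    unfolding U_def
    by (rule compound_counterpart_rotation_pi[OF assms(8,19) n_axis(2) assms(6) n_axis(1)])
  have b_norm: "(norm b_AB)\<^sup>2 = b_AB \<bullet> b_AB"
    by (simp add: dot_square_norm)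
  have twin_BB': "R_BB' ** U B' - U B = b_BB' \<otimes> n_AA'"
    using assms(24,27) by simp
  note II = type_II_twin_rotation[OF U UV p UB assms(21,9) b assms(13)]
  note I = type_I_twin[OF U UV assms(19) UA' assms(23,11)]
  note D = double_twin[OF U UV p UB assms(9,21) b assms(13,19) np UA' UB' assms(11,23,12) twin_BB',
      folded b_norm, folded \<eta>_def]
  have Vb: "V *v b_AB = c *\<^sub>R p"
    using inverse_symmetric(1)[OF U UV]
    by (simp add: b matrix_vector_mult_scaleR matrix_vector_mul_assoc)
  have nb: "n_AB \<bullet> (V *v b_AB) = 0" and mb: "n_AA' \<bullet> (V *v b_AB) = 0"
    using II(1) np by (simp_all add: Vb)

  define F where "F l L = U A + l *\<^sub>R (b_AB \<otimes> n_AB) + L *\<^sub>R (b_AA' \<otimes> n_AA')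
      - (\<eta> * l * L) *\<^sub>R (b_AB \<otimes> n_AA')" for l L
  have side: "R_AB ** U B = U A + b_AB \<otimes> n_AB" "R_AA' ** U A' = U A + b_AA' \<otimes> n_AA'"
    using assms(21,23) by (simp_all add: algebra_simps)
  \<comment> \<open>\<open>M\<close> is affine in each variable, hence fixed by its four corner
    values. The compatibility of the rotations lets the fourth corner be reached through
    \<open>B\<close>, where \<open>double_twin\<close> supplies
    \<open>R_AB *v b_BB'\<close>.\<close>
  have "R_AA' ** (R_A'B' ** U B') = R_AB ** (R_BB' ** U B')"
    by (simp add: matrix_mul_assoc assms(28))
  also have "R_BB' ** U B' = U B + b_BB' \<otimes> n_AA'"
    using twin_BB' by (simp add: algebra_simps)
  also have "R_AB ** \<dots> = U A + b_AB \<otimes> n_AB + (b_AA' - \<eta> *\<^sub>R b_AB) \<otimes> n_AA'"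
    by (simp add: matrix_add_ldistrib matrix_mult_outer side D(3))
  finally have corner: "R_AA' ** (R_A'B' ** U B') = U A + b_AB \<otimes> n_AB + (b_AA' - \<eta> *\<^sub>R b_AB) \<otimes> n_AA'" .
  have "M l L = F l L" for l L
    unfolding M_def M_AB_def M_A'B'_def F_def matrix_add_ldistrib matrix_scalar_ac
      scalar_matrix_assoc[symmetric] corner side
    by (simp add: outer_linear algebra_simps)
  then have g: "g l L = det (transpose (F l L) ** F l L - mat 1)" for l L
    by (simp add: g_def)
  have g_A: "g l L = det (A\<^sub>0 + l *\<^sub>R A\<^sub>1 + L *\<^sub>R A\<^sub>2 + (l * L) *\<^sub>R A\<^sub>3)" for l L
    unfolding g F_def A\<^sub>0_def A\<^sub>1_def A\<^sub>2_def A\<^sub>3_def V_def[symmetric]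
    by (rule det_gram_double_laminate[OF U UV nb mb D(1)])
  have "F (1 - l) L ** rotation_pi p = (R_AB ** rotation_pi p) ** F l L" for l L
    unfolding F_def \<eta>_def b_norm
    by (rule laminate_swap_type_II[OF U b assms(13) II(1) np II(2,3)])
  \<comment> \<open>The symmetries are established for all real arguments, since the comparison of
    coefficients evaluates outside the unit interval.\<close>
  then have sym_l: "g (1 - l) L = g l L" for l L
    unfolding g by (rule det_gram_conjugate) (intro rotation_matrix_mult rotation_matrix_rotation_pi p assms(9))+
  have "F l (1 - L) ** rotation_pi n_AA' = (R_AA' ** rotation_pi n_AA') ** F l L" for l L
    unfolding F_def by (rule laminate_swap_type_I[OF U UV assms(19) mb D(1,2) I(3)])
  then have sym_L: "g l (1 - L) = g l L" for l L
    unfolding g by (rule det_gram_conjugate) (intro rotation_matrix_mult rotation_matrix_rotation_pi assms(11,19))+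

  have a1: "a\<^sub>1 = - matrix_inner (cof A\<^sub>0) A\<^sub>1"
    unfolding a\<^sub>1_def A\<^sub>0_def A\<^sub>1_def V_def[symmetric] matrix_inner_cof_twin[OF U UV nb] by simp
  have a2: "a\<^sub>2 = - matrix_inner (cof A\<^sub>0) A\<^sub>2"
    unfolding a\<^sub>2_def A\<^sub>0_def A\<^sub>2_def V_def[symmetric] matrix_inner_cof_twin[OF U UV D(1)] by simp
  have a3: "a\<^sub>3 = 4 * matrix_inner (cof (A\<^sub>0 + (1/2) *\<^sub>R A\<^sub>2)) (A\<^sub>1 + (1/2) *\<^sub>R A\<^sub>3) - 4 * matrix_inner (cof A\<^sub>0) A\<^sub>1"
    by (simp add: a\<^sub>3_def a1)
  have main: "g l L = a\<^sub>0 + a\<^sub>1 * (l\<^sup>2 - l) + a\<^sub>2 * (L\<^sup>2 - L) + a\<^sub>3 * (l\<^sup>2 - l) * (L\<^sup>2 - L)" for l L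
    using double_symmetric_det[of A\<^sub>0 A\<^sub>1 A\<^sub>2 A\<^sub>3 l L] sym_l sym_L
    unfolding g_A a1 a2 a3 by (simp add: a\<^sub>0_def A\<^sub>0_def)
  have "g l L = 0 \<longleftrightarrow> l\<^sup>2 - l = - ((a\<^sub>0 + a\<^sub>2 * (L\<^sup>2 - L)) / (a\<^sub>1 + a\<^sub>3 * (L\<^sup>2 - L)))"
    if "a\<^sub>3 \<noteq> 0" "a\<^sub>1 / a\<^sub>3 \<notin> {0..1/4}" and L: "L \<in> {0..1}" for l L
  proof -
    \<comment> \<open>On the unit interval \<open>L\<^sup>2 - L\<close> ranges within
      \<open>[-1/4, 0]\<close>, so the condition on \<open>a\<^sub>1 / a\<^sub>3\<close> keeps the
      coefficient of \<open>l\<^sup>2 - l\<close> away from zero and the equation can be solved for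
      it.\<close>
    have "0 \<le> L * (1 - L)" "0 \<le> (L - 1/2)\<^sup>2"
      using L by simp_all
    then have "- (L\<^sup>2 - L) \<in> {0..1/4}"
      by (simp add: power2_eq_square algebra_simps)
    then have "a\<^sub>1 / a\<^sub>3 \<noteq> - (L\<^sup>2 - L)"
      using that(2) by metis
    then have "a\<^sub>1 + a\<^sub>3 * (L\<^sup>2 - L) \<noteq> 0"
      using that(1) by (simp add: field_simps)
    then show ?thesis
      unfolding main by (auto simp: field_simps)
  qed
  with main show ?thesis
    by blast
qed

end
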